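(* Let $L>0$, let $h:\mathbb R\to\mathbb R$ be an $L$-Lipschitz mapping, and let $0<t\le\frac{1}{1+L}$. Let $e\in\mathbb R$, put $x_0=e$, and define $$x_{n+1}=(1-t)x_n+t\,h(x_n)\quad\text{for each } n\ge 0.$$ Then $\{x_n\}$ is a monotone sequence that either converges to a fixed point of $h$ or diverges to infinity (that is, $x_n\to+\infty$ or $x_n\to-\infty$).
   Context: A function $h:\mathbb R\to\mathbb R$ is called $L$-Lipschitz (for $L>0$) if $|h(x)-h(y)|\le L|x-y|$ for all $x,y\in\mathbb R$. A fixed point of $h$ is a point $x$ with $h(x)=x$. Monotone means nondecreasing or nonincreasing (constant sequences are included). *)

theory Defs
  imports "HOL-Analysis.Analysis"
begin

end

theory Submission
  imports Defs
begin

text \<open>The bound on \<open>t\<close> makes the averaged map \<open>g y = (1 - t) y + t h y\<close> nondecreasing, so the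
  sign of \<open>g (x 0) - x 0\<close> decides the direction of the whole orbit. A monotone real sequence
  converges or diverges to infinity, and by continuity a limit of the orbit is fixed by \<open>g\<close>,
  hence by \<open>h\<close>.\<close>

text \<open>From \<open>a\<close> to \<open>b\<close>, the term \<open>t * h y\<close> drops by at
  most \<open>t * L * (b - a)\<close>, while \<open>(1 - t) * y\<close> changes by exactly
  \<open>(1 - t) * (b - a)\<close>. The net change is at least
  \<open>(1 - t * (1 + L)) * (b - a)\<close>, which is nonnegative.\<close>

lemma mono_averaged_map:
  fixes h :: "real \<Rightarrow> real"
  assumes "L-lipschitz_on UNIV h" "0 \<le> t" "t * (1 + L) \<le> 1"
  shows "mono (\<lambda>y. (1 - t) * y + t * h y)"
proof (rule monoI)
  fix a b :: real
  assume "a \<le> b"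
  have "\<bar>h a - h b\<bar> \<le> L * (b - a)"
    using lipschitz_onD[OF assms(1), of a b] \<open>a \<le> b\<close> by (simp add: dist_real_def)
  then have "t * (h a - h b) \<le> t * (L * (b - a))"
    using \<open>0 \<le> t\<close> by (intro mult_left_mono) auto
  moreover have "0 \<le> (1 - t * (1 + L)) * (b - a)"
    using assms(3) \<open>a \<le> b\<close> by simp
  ultimately show "(1 - t) * a + t * h a \<le> (1 - t) * b + t * h b"
    by (simp add: algebra_simps)
qed

text \<open>The order between \<open>x 0\<close> and \<open>x 1\<close> is carried along the orbit:
  applying the monotone \<open>g\<close> to both sides of one comparison gives the next.\<close>

lemma monoseq_iterates:
  fixes g :: "'a::linorder \<Rightarrow> 'a"
  assumes "mono g" and x: "\<And>n. x (Suc n) = g (x n)"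
  shows "monoseq x"
proof (cases "x 0 \<le> x 1")
  case True
  have "x n \<le> x (Suc n)" for n
    by (induction n) (use True x monoD[OF \<open>mono g\<close>] in auto)
  then show ?thesis by (simp add: monoseq_Suc)
next
  case False
  have "x (Suc n) \<le> x n" for n
    by (induction n) (use False x monoD[OF \<open>mono g\<close>] in auto)
  then show ?thesis by (simp add: monoseq_Suc)
qed

lemma incseq_convergent_or_at_top:
  fixes x :: "nat \<Rightarrow> real"
  assumes "incseq x"
  shows "convergent x \<or> filterlim x at_top sequentially"
proof (cases "\<exists>B. \<forall>n. x n \<le> B")
  case True
  then show ?thesis
    using incseq_convergent[OF assms] by (metis convergent_def)
next
  case False
  have "\<forall>\<^sub>F n in sequentially. B \<le> x n" for B
  proof -
    \<comment> \<open>Since \<open>B\<close> is not an upper bound, some term reaches it, and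
      monotonicity keeps all later terms above it.\<close>
    obtain N where "B \<le> x N" using False by (meson linear)
    then show ?thesis
      using incseqD[OF assms] by (intro eventually_sequentiallyI[of N]) (meson order_trans)
  qed
  then show ?thesis by (simp add: filterlim_at_top)
qed

lemma monoseq_convergent_or_at_infinity:
  fixes x :: "nat \<Rightarrow> real"
  assumes "monoseq x"
  shows "convergent x \<or> filterlim x at_top sequentially \<or> filterlim x at_bot sequentially"
proof (cases "incseq x")
  case True
  then show ?thesis using incseq_convergent_or_at_top by blast
next
  case False
  \<comment> \<open>Negation reduces the decreasing case to the increasing one and swaps
    \<open>at_top\<close> with \<open>at_bot\<close>.\<close>
  then have "incseq (\<lambda>n. - x n)"
    using assms by (simp add: monoseq_iff decseq_eq_incseq)
  then have "convergent (\<lambda>n. - x n) \<or> filterlim (\<lambda>n. - x n) at_top sequentially"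
    by (rule incseq_convergent_or_at_top)
  then show ?thesis by (auto simp: convergent_minus_iff[symmetric] filterlim_uminus_at_bot)
qed

text \<open>The shifted orbit tends to \<open>g p\<close> by continuity and to \<open>p\<close> as a
  tail of \<open>x\<close>; limits in a Hausdorff space are unique.\<close>

lemma limit_of_iterates_fixed_point:
  fixes g :: "'a::t2_space \<Rightarrow> 'a"
  assumes "isCont g p" "x \<longlonglongrightarrow> p" and x: "\<And>n. x (Suc n) = g (x n)"
  shows "g p = p"
proof (rule LIMSEQ_unique)
  show "(\<lambda>n. x (Suc n)) \<longlonglongrightarrow> g p"
    unfolding x using assms(1,2) by (rule isCont_tendsto_compose)
  show "(\<lambda>n. x (Suc n)) \<longlonglongrightarrow> p"
    using assms(2) by (rule LIMSEQ_Suc)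
qed

theorem theorem2p1:
  fixes L t e :: real and h :: "real \<Rightarrow> real" and x :: "nat \<Rightarrow> real"
  assumes "L > 0"
    and "L-lipschitz_on UNIV h"
    and "0 < t" and "t \<le> 1 / (1 + L)"
    and "x 0 = e"
    and "\<And>n. x (Suc n) = (1 - t) * x n + t * h (x n)"
  shows "monoseq x \<and>
    ((\<exists>p. h p = p \<and> x \<longlonglongrightarrow> p) \<or>
     filterlim x at_top sequentially \<or>
     filterlim x at_bot sequentially)"
proof -
  define g where "g y = (1 - t) * y + t * h y" for y
  have x: "x (Suc n) = g (x n)" for n
    using assms(6) by (simp add: g_def)
  have "t * (1 + L) \<le> 1"
    using assms(1,4) by (simp add: field_simps)
  then have "mono g"
    unfolding g_def using mono_averaged_map assms(2,3) by simp
  then have "monoseq x"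
    using x by (rule monoseq_iterates)
  moreover have "h p = p" if "x \<longlonglongrightarrow> p" for p
  proof -
    have "isCont h p"
      using lipschitz_on_continuous_on[OF assms(2)] by (simp add: continuous_on_eq_continuous_at)
    then have "isCont g p"
      unfolding g_def by (intro continuous_intros)
    then have "g p = p"
      using that x by (rule limit_of_iterates_fixed_point)
    \<comment> \<open>The difference \<open>g p - p\<close> equals \<open>t * (h p - p)\<close>, so
      a positive \<open>t\<close> can be cancelled.\<close>
    then have "t * (h p - p) = 0"
      by (simp add: g_def algebra_simps)
    then show ?thesis using \<open>0 < t\<close> by simp
  qed
  ultimately show ?thesis
    using monoseq_convergent_or_at_infinity by (metis convergent_def)
qed

end
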